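(* Let $A=\{a_1<a_2<\cdots\}$ be an infinite totally ordered alphabet and $\mathbb{K}$ a field. For permutations $\alpha\in\mathfrak{S}_k$ and $\beta\in\mathfrak{S}_l$ ($k,l\ge 1$), $$\mathbf{G}_\alpha\#\mathbf{G}_\beta=\sum_{\gamma\in[\alpha\wedge\beta,\ \alpha\vee\beta]}\mathbf{G}_\gamma,$$ where the interval is taken in $\mathfrak{S}_{k+l-1}$ for the left weak order. In particular, the set of permutations appearing in $\mathbf{G}_\alpha\#\mathbf{G}_\beta$ is this interval, each with coefficient $1$.
   Context: Work in the space of formal (possibly infinite) $\mathbb{K}$-linear combinations of nonempty words over $A$. The $\#$ product of words is defined by $(ux)\#(yv)=uxv$ if the letters $x,y$ are equal and $0$ otherwise (where $u,v$ are words and $x,y$ letters), extended bilinearly; for homogeneous series of degrees $k$ and $l$ this is well defined since a word of length $k+l-1$ arises from at most one pair of words. The standardization $\mathrm{std}(w)$ of a word $w$ of length $n$ is the permutation of $\{1,\dots,n\}$ obtained by scanning $w$ left to right and numbering $1,2,\dots$ the occurrences of its smallest letter, then those of the next smallest letter, and so on. For $\sigma\in\mathfrak{S}_n$, $\mathbf{G}_\sigma=\sum_{\mathrm{std}(w)=\sigma}w$. For $\sigma\in\mathfrak{S}_n$ let $\mathrm{Inv}(\sigma)=\{(i,j):1\le i<j\le n,\ \sigma_i>\sigma_j\}$; the left weak order is $\sigma\le\tau$ iff $\mathrm{Inv}(\sigma)\subseteq\mathrm{Inv}(\tau)$. For $\alpha\in\mathfrak{S}_k$, $\beta\in\mathfrak{S}_l$,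 the word $\alpha\vee\beta\in\mathfrak{S}_{k+l-1}$ is obtained by first writing, for $i=1,\dots,k$, the value $\alpha_i+\beta_1-1$ if $\alpha_i\le\alpha_k$ and $\alpha_i+\max(\beta)-1$ if $\alpha_i>\alpha_k$; then writing, for $i=2,\dots,l$, the value $\beta_i$ if $\beta_i<\beta_1$ and $\beta_i+\alpha_k-1$ if $\beta_i\ge\beta_1$. The word $\alpha\wedge\beta$ is obtained by first writing, for $i=1,\dots,k$, $\alpha_i$ if $\alpha_i<\alpha_k$ and $\alpha_i+\beta_1-1$ if $\alpha_i\ge\alpha_k$; then, for $i=2,\dots,l$, $\beta_i+\alpha_k-1$ if $\beta_i\le\beta_1$ and $\beta_i+\max(\alpha)-1$ if $\beta_i>\beta_1$. (For example $3412\vee35124=78346125$ and $3412\wedge35124=56148237$.) *)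

theory Defs
  imports "HOL-Combinatorics.Multiset_Permutations"
begin

text \<open>
  Permutations of \<open>{1..n}\<close> are words in one-line notation, i.e. elements of
  \<open>permutations_of_set {1..n}\<close>; the letter written \<open>\<sigma>\<^sub>i\<close> in the literature is \<open>\<sigma> ! (i - 1)\<close>.
\<close>

text \<open>
  A formal, possibly infinite, linear combination of nonempty words is its coefficient function.
  The value at the empty word carries no information: it is never used by the product below,
  and it is \<open>0\<close> for all series that occur.
\<close>
type_synonym ('a, 'k) series = "'a list \<Rightarrow> 'k"

text \<open>On nonempty words, \<open>None\<close> stands for the zero element.\<close>
definition word_sharp :: "'a list \<Rightarrow> 'a list \<Rightarrow> 'a list option" where
  "word_sharp p q = (if last p = hd q then Some (butlast p @ [last p] @ tl q) else None)"

text \<open>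
  The bilinear extension. The sum is always finite (see below), so this makes sense for arbitrary
  series; for homogeneous series it has at most one term that can be nonzero.
\<close>
definition sharp :: "('a, 'k::field) series \<Rightarrow> ('a, 'k) series \<Rightarrow> ('a, 'k) series" where
  "sharp f g w =
     (\<Sum>(p, q) \<in> {(p, q). p \<noteq> [] \<and> q \<noteq> [] \<and> word_sharp p q = Some w}. f p * g q)"

text \<open>
  The positions \<open>0, \<dots>, length w - 1\<close> of \<open>w\<close> in the order in which standardization numbers them:
  all occurrences of the smallest letter from left to right, then those of the next one, etc.
\<close>
definition scan_positions :: "'a::linorder list \<Rightarrow> nat list" where
  "scan_positions w =
     concat (map (\<lambda>x. filter (\<lambda>i. w ! i = x) [0..<length w]) (sorted_list_of_set (set w)))"

definition std :: "'a::linorder list \<Rightarrow> nat list" where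
  "std w = map (\<lambda>i. the (map_of (zip (scan_positions w) [1..<Suc (length w)]) i)) [0..<length w]"

definition G :: "nat list \<Rightarrow> ('a::linorder, 'k::field) series" where
  "G \<sigma> w = (if std w = \<sigma> then 1 else 0)"

definition Inv :: "nat list \<Rightarrow> (nat \<times> nat) set" where
  "Inv \<sigma> = {(i, j). 1 \<le> i \<and> i < j \<and> j \<le> length \<sigma> \<and> \<sigma> ! (i - 1) > \<sigma> ! (j - 1)}"

definition left_weak_le :: "nat list \<Rightarrow> nat list \<Rightarrow> bool" where
  "left_weak_le \<sigma> \<tau> \<longleftrightarrow> Inv \<sigma> \<subseteq> Inv \<tau>"

definition left_weak_interval :: "nat \<Rightarrow> nat list \<Rightarrow> nat list \<Rightarrow> nat list set" where
  "left_weak_interval n \<sigma> \<tau> =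
     {\<gamma> \<in> permutations_of_set {1..n}. left_weak_le \<sigma> \<gamma> \<and> left_weak_le \<gamma> \<tau>}"

definition vee :: "nat list \<Rightarrow> nat list \<Rightarrow> nat list" where
  "vee \<alpha> \<beta> =
     map (\<lambda>x. if x \<le> last \<alpha> then x + hd \<beta> - 1 else x + Max (set \<beta>) - 1) \<alpha> @
     map (\<lambda>y. if y < hd \<beta> then y else y + last \<alpha> - 1) (tl \<beta>)"

definition wedge :: "nat list \<Rightarrow> nat list \<Rightarrow> nat list" where
  "wedge \<alpha> \<beta> =
     map (\<lambda>x. if x < last \<alpha> then x else x + hd \<beta> - 1) \<alpha> @
     map (\<lambda>y. if y \<le> hd \<beta> then y + last \<alpha> - 1 else y + Max (set \<alpha>) - 1) (tl \<beta>)"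

lemma finite_sharp_pairs:
  "finite {(p, q). p \<noteq> [] \<and> q \<noteq> [] \<and> word_sharp p q = Some (w :: 'a list)}"
proof (rule finite_subset)
  let ?L = "{xs. set xs \<subseteq> set w \<and> length xs \<le> length w}"
  show "{(p, q). p \<noteq> [] \<and> q \<noteq> [] \<and> word_sharp p q = Some w} \<subseteq> ?L \<times> ?L"
  proof clarify
    fix p q assume pq: "p \<noteq> []" "q \<noteq> []" "word_sharp p q = Some w"
    obtain u x where p: "p = u @ [x]" using pq(1) by (cases p rule: rev_cases) auto
    obtain y v where q: "q = y # v" using pq(2) by (cases q) auto
    have "x = y" "w = u @ x # v" using pq(3) by (auto simp: word_sharp_def p q split: if_splits)
    then show "p \<in> ?L \<and> q \<in> ?L" by (auto simp: p q)
  qed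
  show "finite (?L \<times> ?L)" by (intro finite_cartesian_product finite_lists_length_le) auto
qed

lemma "std [2, 1, 2, 1, 3 :: nat] = [3, 1, 4, 2, 5]"
  by code_simp

lemma "vee [3, 4, 1, 2] [3, 5, 1, 2, 4] = [7, 8, 3, 4, 6, 1, 2, 5]"
  by (simp add: vee_def)

lemma "wedge [3, 4, 1, 2] [3, 5, 1, 2, 4] = [5, 6, 1, 4, 8, 2, 3, 7]"
  by (simp add: wedge_def)

end

theory Submission
  imports Defs
begin

text \<open>
  A permutation \<open>\<sigma>\<close> of \<open>{1..n}\<close> is the standardization of \<open>w\<close> iff \<open>w\<close> and \<open>\<sigma>\<close> have the same
  inversions. Hence a word \<open>w\<close> of length \<open>k + l - 1\<close> occurs in the product iff its prefix of length
  \<open>k\<close> has the inversions of \<open>\<alpha>\<close> and its suffix of length \<open>l\<close> has those of \<open>\<beta>\<close>; the two factors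
  overlap in the \<open>k\<close>-th letter. Both \<open>\<alpha> \<and> \<beta>\<close> and \<open>\<alpha> \<or> \<beta>\<close> satisfy this, and for positions
  \<open>i < k < j\<close> the former has only the inversions forced by \<open>w\<^sub>i > w\<^sub>k > w\<^sub>j\<close>, the latter lacks only
  those excluded by \<open>w\<^sub>i \<le> w\<^sub>k \<le> w\<^sub>j\<close>.
\<close>

section \<open>Words with the same inversions\<close>

text \<open>The words may be over different ordered alphabets, so that a word can be compared with a
  permutation. Equal letters form no inversion, in accordance with their left-to-right numbering by
  \<open>std\<close>.\<close>

definition same_inversions :: "'a::linorder list \<Rightarrow> 'b::linorder list \<Rightarrow> bool" where
  "same_inversions u v \<longleftrightarrow>
     length u = length v \<and> (\<forall>j<length u. \<forall>i<j. u ! j < u ! i \<longleftrightarrow> v ! j < v ! i)"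

lemma same_inversions_sym: "same_inversions u v \<Longrightarrow> same_inversions v u"
  by (auto simp: same_inversions_def)

lemma same_inversions_trans:
  "same_inversions u v \<Longrightarrow> same_inversions v w \<Longrightarrow> same_inversions u w"
  by (auto simp: same_inversions_def)

lemma same_inversions_take: "same_inversions u v \<Longrightarrow> same_inversions (take n u) (take n v)"
  by (auto simp: same_inversions_def)

lemma same_inversions_drop: "same_inversions u v \<Longrightarrow> same_inversions (drop n u) (drop n v)"
  by (auto simp: same_inversions_def)

text \<open>Serves to realize a permutation as a word over the alphabet, with its entries renamed
  along \<open>a\<close>.\<close>

lemma same_inversions_map:
  assumes "strict_mono f"
  shows "same_inversions (map f u) u"
  using assms by (auto simp: same_inversions_def strict_mono_less)


subsection \<open>Standardization\<close>

text \<open>The strict total order in which standardization numbers positions: first by letter, then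
  from left to right.\<close>

definition scan_less :: "'a::linorder list \<Rightarrow> nat \<Rightarrow> nat \<Rightarrow> bool" where
  "scan_less w i j \<longleftrightarrow> w ! i < w ! j \<or> w ! i = w ! j \<and> i < j"

lemma scan_less_asym: "scan_less w i j \<Longrightarrow> \<not> scan_less w j i"
  by (auto simp: scan_less_def)

lemma scan_less_total: "i \<noteq> j \<Longrightarrow> scan_less w i j \<or> scan_less w j i"
  by (auto simp: scan_less_def)

lemma sorted_scan_positions: "sorted_wrt (scan_less w) (scan_positions w)"
proof -
  \<comment> \<open>The induction needs an arbitrary strictly increasing list \<open>xs\<close> of
    letters. Within a block the letter is constant and positions increase; different blocks are
    ordered by their letters.\<close>
  have "sorted_wrt (scan_less w) (concat (map (\<lambda>x. filter (\<lambda>i. w ! i = x) [0..<length w]) xs))"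
    if "sorted_wrt (<) xs" for xs
    using that
  proof (induction xs)
    case (Cons x xs)
    have "sorted_wrt (scan_less w) (filter (\<lambda>i. w ! i = x) [0..<length w])"
      by (rule sorted_wrt_mono_rel[OF _ sorted_wrt_filter[OF sorted_wrt_upt]])
        (auto simp: scan_less_def)
    moreover have "\<forall>i\<in>set (filter (\<lambda>i. w ! i = x) [0..<length w]).
        \<forall>j\<in>set (concat (map (\<lambda>x. filter (\<lambda>i. w ! i = x) [0..<length w]) xs)). scan_less w i j"
      using Cons.prems by (auto simp: scan_less_def)
    ultimately show ?case
      using Cons by (simp add: sorted_wrt_append)
  qed simp
  then show ?thesis by (simp add: scan_positions_def)
qed

lemma set_scan_positions: "set (scan_positions w) = {..<length w}"
  by (auto simp: scan_positions_def)

lemma distinct_scan_positions: "distinct (scan_positions w)"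
  using sorted_scan_positions[of w]
  by (auto simp: distinct_conv_nth sorted_wrt_iff_nth_less) (metis nat_neq_iff scan_less_asym)

lemma length_scan_positions: "length (scan_positions w) = length w"
  using distinct_card[OF distinct_scan_positions[of w]] by (simp add: set_scan_positions)

lemma length_std [simp]: "length (std w) = length w"
  by (simp add: std_def)

lemma scan_positions_less: "p < length w \<Longrightarrow> scan_positions w ! p < length w"
  using set_scan_positions[of w] length_scan_positions[of w] nth_mem by fastforce

text \<open>Up to the shift from positions, which start at 0, to labels, which start at 1,
  \<open>std w\<close> is the inverse of \<open>scan_positions w\<close>.\<close>

lemma std_nth_scan_positions:
  assumes "p < length w"
  shows "std w ! (scan_positions w ! p) = Suc p"
proof -
  have "map_of (zip (scan_positions w) [1..<Suc (length w)]) (scan_positions w ! p)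
      = Some ([1..<Suc (length w)] ! p)"
    using assms
    by (intro map_of_zip_nth) (simp_all add: length_scan_positions distinct_scan_positions)
  then show ?thesis
    using assms by (simp add: std_def scan_positions_less del: upt_Suc)
qed

lemma scan_positions_cases:
  assumes "i < length w"
  obtains p where "p < length w" "i = scan_positions w ! p"
  using assms set_scan_positions[of w] length_scan_positions[of w]
  by (metis in_set_conv_nth lessThan_iff)

text \<open>The label of a position is its rank in the scan, and the scan is sorted by
  \<open>scan_less\<close>.\<close>

lemma std_less_iff:
  assumes "i < length w" "j < length w"
  shows "std w ! i < std w ! j \<longleftrightarrow> scan_less w i j"
proof -
  obtain p q where p: "p < length w" "i = scan_positions w ! p"
    and q: "q < length w" "j = scan_positions w ! q"
    using assms by (metis scan_positions_cases)
  have "p < q \<Longrightarrow> scan_less w i j" "q < p \<Longrightarrow> scan_less w j i"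
    using sorted_scan_positions[of w] p q
    by (auto simp: sorted_wrt_iff_nth_less length_scan_positions)
  moreover have "\<not> scan_less w i i"
    by (simp add: scan_less_def)
  ultimately have "p < q \<longleftrightarrow> scan_less w i j"
    using p q scan_less_asym by (metis nat_neq_iff)
  then show ?thesis
    using p q by (simp add: std_nth_scan_positions)
qed

text \<open>For \<open>i < j\<close> the tie clause of \<open>scan_less w j i\<close> would require
  \<open>j < i\<close>, so only \<open>w ! j < w ! i\<close> remains.\<close>

lemma same_inversions_std: "same_inversions (std w) w"
  by (auto simp: same_inversions_def std_less_iff scan_less_def)

lemma std_permutation: "std w \<in> permutations_of_set {1..length w}"
proof -
  have "distinct (std w)"
    unfolding distinct_conv_nth using std_less_iff[of _ w] scan_less_total[of _ _ w]
    by (metis length_std nat_neq_iff)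
  moreover have "set (std w) \<subseteq> {1..length w}"
  proof
    fix x assume "x \<in> set (std w)"
    then obtain i where "i < length w" "x = std w ! i"
      by (auto simp: in_set_conv_nth)
    then show "x \<in> {1..length w}"
      by (metis std_nth_scan_positions scan_positions_cases atLeastAtMost_iff Suc_leI le_add1
          plus_1_eq_Suc)
  qed
  ultimately show ?thesis
    by (auto simp: permutations_of_set_def card_subset_eq distinct_card)
qed

section \<open>Permutations are determined by their inversions\<close>

text \<open>An entry of a permutation is the number of entries not exceeding it. The condition is
  split at \<open>j\<close> so that it only asks which pairs of positions are inversions.\<close>

lemma permutation_nth:
  assumes "\<sigma> \<in> permutations_of_set {1..n}" "j < n"
  shows "\<sigma> ! j = card {i. i < n \<and> (if i \<le> j then \<not> \<sigma> ! j < \<sigma> ! i else \<sigma> ! i < \<sigma> ! j)}"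
    (is "_ = card ?S")
proof -
  have \<sigma>: "set \<sigma> = {1..n}" "distinct \<sigma>" "length \<sigma> = n"
    using assms permutations_of_set_def
    by (auto simp: permutations_of_setD length_finite_permutations_of_set)
  have "?S = {i. i < n \<and> \<sigma> ! i \<le> \<sigma> ! j}"
  proof (intro Collect_cong conj_cong refl)
    fix i assume "i < n"
    then show "(if i \<le> j then \<not> \<sigma> ! j < \<sigma> ! i else \<sigma> ! i < \<sigma> ! j) \<longleftrightarrow> \<sigma> ! i \<le> \<sigma> ! j"
      using \<sigma> assms(2) nth_eq_iff_index_eq[of \<sigma> i j] by auto
  qed
  \<comment> \<open>Every value in \<open>{1..\<sigma> ! j}\<close> is attained at exactly one
    position, so the positions counted biject with these values.\<close>
  moreover have "bij_betw ((!) \<sigma>) {i. i < n \<and> \<sigma> ! i \<le> \<sigma> ! j} {1..\<sigma> ! j}"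
  proof (rule bij_betw_imageI)
    show "inj_on ((!) \<sigma>) {i. i < n \<and> \<sigma> ! i \<le> \<sigma> ! j}"
      using \<sigma> by (auto simp: inj_on_def nth_eq_iff_index_eq)
    have mem: "\<sigma> ! i \<in> {1..n}" if "i < n" for i
      using that \<sigma> nth_mem by metis
    have "x \<in> (!) \<sigma> ` {i. i < n \<and> \<sigma> ! i \<le> \<sigma> ! j}" if "x \<in> {1..\<sigma> ! j}" for x
    proof -
      have "x \<in> set \<sigma>"
        using that mem[OF assms(2)] \<sigma> by auto
      then obtain i where "i < n" "x = \<sigma> ! i"
        using \<sigma>(3) by (auto simp: in_set_conv_nth)
      then show ?thesis
        using that by auto
    qed
    then show "(!) \<sigma> ` {i. i < n \<and> \<sigma> ! i \<le> \<sigma> ! j} = {1..\<sigma> ! j}"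
      using mem by auto
  qed
  ultimately show ?thesis
    using bij_betw_same_card by fastforce
qed

lemma permutation_eqI:
  fixes n :: nat
  assumes "\<sigma> \<in> permutations_of_set {1..n}" "\<tau> \<in> permutations_of_set {1..n}"
    and "same_inversions \<sigma> \<tau>"
  shows "\<sigma> = \<tau>"
proof (rule nth_equalityI)
  have len: "length \<sigma> = n" "length \<tau> = n"
    using assms by (auto simp: length_finite_permutations_of_set)
  then show "length \<sigma> = length \<tau>" by simp
  fix j assume "j < length \<sigma>"
  then have j: "j < n" by (simp add: len)
  have "{i. i < n \<and> (if i \<le> j then \<not> \<sigma> ! j < \<sigma> ! i else \<sigma> ! i < \<sigma> ! j)}
      = {i. i < n \<and> (if i \<le> j then \<not> \<tau> ! j < \<tau> ! i else \<tau> ! i < \<tau> ! j)}"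
    using assms(3) j len by (auto simp: same_inversions_def not_le le_less)
  then show "\<sigma> ! j = \<tau> ! j"
    using permutation_nth[OF assms(1) j] permutation_nth[OF assms(2) j] by simp
qed

text \<open>Both \<open>std w\<close> and a permutation with the inversions of \<open>w\<close> are
  permutations with the same inversions, hence equal. This turns the support of
  \<open>G \<sigma>\<close> into an inversion condition.\<close>

lemma std_eq_iff:
  assumes "\<sigma> \<in> permutations_of_set {1..n}"
  shows "std w = \<sigma> \<longleftrightarrow> same_inversions w \<sigma>"
proof
  assume "std w = \<sigma>"
  then show "same_inversions w \<sigma>"
    using same_inversions_std same_inversions_sym by blast
next
  assume *: "same_inversions w \<sigma>"
  moreover have "length \<sigma> = n"
    using assms by (auto simp: length_finite_permutations_of_set)
  ultimately have "length w = n"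
    by (simp add: same_inversions_def)
  then show "std w = \<sigma>"
    using permutation_eqI[OF _ assms] std_permutation same_inversions_trans[OF same_inversions_std *]
    by metis
qed


subsection \<open>The weak order interval and the product\<close>

lemma left_weak_le_iff:
  assumes "length \<sigma> = n" "length \<tau> = n"
  shows "left_weak_le \<sigma> \<tau> \<longleftrightarrow> (\<forall>j<n. \<forall>i<j. \<sigma> ! j < \<sigma> ! i \<longrightarrow> \<tau> ! j < \<tau> ! i)"
proof
  assume le: "left_weak_le \<sigma> \<tau>"
  show "\<forall>j<n. \<forall>i<j. \<sigma> ! j < \<sigma> ! i \<longrightarrow> \<tau> ! j < \<tau> ! i"
  proof (intro allI impI)
    fix i j assume "j < n" "i < j" "\<sigma> ! j < \<sigma> ! i"
    then have "(Suc i, Suc j) \<in> Inv \<sigma>"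
      using assms by (auto simp: Inv_def)
    then have "(Suc i, Suc j) \<in> Inv \<tau>"
      using le by (auto simp: left_weak_le_def)
    then show "\<tau> ! j < \<tau> ! i"
      by (simp add: Inv_def)
  qed
next
  assume *: "\<forall>j<n. \<forall>i<j. \<sigma> ! j < \<sigma> ! i \<longrightarrow> \<tau> ! j < \<tau> ! i"
  have "\<tau> ! (j - 1) < \<tau> ! (i - 1)"
    if "1 \<le> i" "i < j" "j \<le> n" "\<sigma> ! (j - 1) < \<sigma> ! (i - 1)" for i j
    \<comment> \<open>Pairs in \<open>Inv\<close> count positions from 1, lists from 0;
      \<open>1 \<le> i\<close> keeps the truncated subtraction exact.\<close>
    using *[rule_format, of "j - 1" "i - 1"] that by simp
  then show "left_weak_le \<sigma> \<tau>"
    using assms by (auto simp: left_weak_le_def Inv_def)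
qed

section \<open>Entries of the bounds and factorizations of a word\<close>

lemma length_vee: "length (vee \<alpha> \<beta>) = length \<alpha> + (length \<beta> - 1)"
  by (simp add: vee_def)

lemma length_wedge: "length (wedge \<alpha> \<beta>) = length \<alpha> + (length \<beta> - 1)"
  by (simp add: wedge_def)

lemma nth_vee_left:
  "i < length \<alpha> \<Longrightarrow> vee \<alpha> \<beta> ! i =
     (if \<alpha> ! i \<le> last \<alpha> then \<alpha> ! i + hd \<beta> - 1 else \<alpha> ! i + Max (set \<beta>) - 1)"
  by (simp add: vee_def nth_append)

lemma nth_wedge_left:
  "i < length \<alpha> \<Longrightarrow> wedge \<alpha> \<beta> ! i = (if \<alpha> ! i < last \<alpha> then \<alpha> ! i else \<alpha> ! i + hd \<beta> - 1)"
  by (simp add: wedge_def nth_append)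

text \<open>
  In the next two lemmas \<open>j = 0\<close> is the overlap position, whose value is defined through \<open>\<alpha>\<close> but is
  also the one prescribed by \<open>\<beta>\<close>.
\<close>

lemma nth_vee_right:
  assumes "\<alpha> \<noteq> []" "j < length \<beta>"
  shows "vee \<alpha> \<beta> ! (length \<alpha> - 1 + j) =
    (if \<beta> ! j < hd \<beta> then \<beta> ! j else \<beta> ! j + last \<alpha> - 1)"
proof (cases j)
  case 0
  then show ?thesis
    using assms by (simp add: nth_vee_left last_conv_nth hd_conv_nth add.commute)
next
  case (Suc m)
  then have "length \<alpha> - 1 + j = length \<alpha> + m"
    using assms by (cases \<alpha>) auto
  then show ?thesis
    using assms Suc by (simp only:) (simp add: vee_def nth_append nth_tl)
qed

lemma nth_wedge_right:
  assumes "\<alpha> \<noteq> []" "j < length \<beta>"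
  shows "wedge \<alpha> \<beta> ! (length \<alpha> - 1 + j) =
    (if \<beta> ! j \<le> hd \<beta> then \<beta> ! j + last \<alpha> - 1 else \<beta> ! j + Max (set \<alpha>) - 1)"
proof (cases j)
  case 0
  then show ?thesis
    using assms by (simp add: nth_wedge_left last_conv_nth hd_conv_nth add.commute)
next
  case (Suc m)
  then have "length \<alpha> - 1 + j = length \<alpha> + m"
    using assms by (cases \<alpha>) auto
  then show ?thesis
    using assms Suc by (simp only:) (simp add: wedge_def nth_append nth_tl)
qed

lemma finite_interval: "finite (left_weak_interval n \<sigma> \<tau>)"
  by (simp add: left_weak_interval_def)

text \<open>The factors share one letter of \<open>w\<close>, the last of \<open>p\<close> and the
  first of \<open>q\<close>. Hence \<open>w\<close> and the length of \<open>p\<close> determine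
  both factors.\<close>

lemma word_sharp_eq_Some_iff:
  assumes "p \<noteq> []" "q \<noteq> []"
  shows "word_sharp p q = Some w \<longleftrightarrow>
    p = take (length p) w \<and> q = drop (length p - 1) w \<and> length p \<le> length w"
proof -
  obtain u x where p: "p = u @ [x]"
    using assms(1) by (cases p rule: rev_cases) auto
  obtain y v where q: "q = y # v"
    using assms(2) by (cases q) auto
  have "word_sharp p q = Some w \<longleftrightarrow> x = y \<and> w = u @ x # v"
    by (auto simp: word_sharp_def p q)
  also have "\<dots> \<longleftrightarrow> u @ [x] = take (Suc (length u)) w \<and> y # v = drop (length u) w \<and> length u < length w"
  proof
    assume *: "u @ [x] = take (Suc (length u)) w \<and> y # v = drop (length u) w \<and> length u < length w"
    then have "u = take (length u) w" "x = w ! length u"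
      by (auto simp: take_Suc_conv_app_nth)
    then show "x = y \<and> w = u @ x # v"
      using * by (metis Cons_nth_drop_Suc append_take_drop_id list.inject)
  qed auto
  finally show ?thesis
    by (simp add: p q Suc_le_eq)
qed

section \<open>Comparison of entries of the two bounds\<close>

locale permutation_pair =
  fixes \<alpha> \<beta> :: "nat list" and k l :: nat
  assumes k: "k \<ge> 1" and l: "l \<ge> 1"
    and \<alpha>: "\<alpha> \<in> permutations_of_set {1..k}" and \<beta>: "\<beta> \<in> permutations_of_set {1..l}"
begin

lemma set_\<alpha>: "set \<alpha> = {1..k}" and set_\<beta>: "set \<beta> = {1..l}"
  using \<alpha> \<beta> by (auto simp: permutations_of_setD)

lemma length_\<alpha>: "length \<alpha> = k" and length_\<beta>: "length \<beta> = l"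
  using \<alpha> \<beta> by (auto simp: length_finite_permutations_of_set)

lemma nonempty: "\<alpha> \<noteq> []" "\<beta> \<noteq> []"
  using k l length_\<alpha> length_\<beta> by auto

lemma Max_\<alpha>: "Max (set \<alpha>) = k" and Max_\<beta>: "Max (set \<beta>) = l"
  using k l unfolding set_\<alpha> set_\<beta> by (auto intro!: Max_eqI)

lemma \<alpha>_bounds: "i < k \<Longrightarrow> 1 \<le> \<alpha> ! i \<and> \<alpha> ! i \<le> k"
  using set_\<alpha> length_\<alpha> nth_mem[of i \<alpha>] by auto

lemma \<beta>_bounds: "i < l \<Longrightarrow> 1 \<le> \<beta> ! i \<and> \<beta> ! i \<le> l"
  using set_\<beta> length_\<beta> nth_mem[of i \<beta>] by auto

lemma last_\<alpha>: "last \<alpha> = \<alpha> ! (k - 1)" and hd_\<beta>: "hd \<beta> = \<beta> ! 0"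
  using nonempty length_\<alpha> by (auto simp: last_conv_nth hd_conv_nth)

lemma last_\<alpha>_bounds: "1 \<le> last \<alpha> \<and> last \<alpha> \<le> k" and hd_\<beta>_bounds: "1 \<le> hd \<beta> \<and> hd \<beta> \<le> l"
  using \<alpha>_bounds[of "k - 1"] \<beta>_bounds[of 0] k l by (auto simp: last_\<alpha> hd_\<beta>)

lemma \<alpha>_ne_last: "i < k - 1 \<Longrightarrow> \<alpha> ! i \<noteq> last \<alpha>"
  using \<alpha> length_\<alpha> by (auto simp: last_\<alpha> nth_eq_iff_index_eq permutations_of_set_def)

lemma \<beta>_ne_hd: "0 < j \<Longrightarrow> j < l \<Longrightarrow> \<beta> ! j \<noteq> hd \<beta>"
  using \<beta> length_\<beta> by (auto simp: hd_\<beta> nth_eq_iff_index_eq permutations_of_set_def)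

lemma vee_left:
  "i < k \<Longrightarrow> vee \<alpha> \<beta> ! i = (if \<alpha> ! i \<le> last \<alpha> then \<alpha> ! i + hd \<beta> - 1 else \<alpha> ! i + l - 1)"
  using nth_vee_left[of i \<alpha> \<beta>] by (simp add: Max_\<beta> length_\<alpha>)

lemma wedge_left:
  "i < k \<Longrightarrow> wedge \<alpha> \<beta> ! i = (if \<alpha> ! i < last \<alpha> then \<alpha> ! i else \<alpha> ! i + hd \<beta> - 1)"
  using nth_wedge_left[of i \<alpha> \<beta>] by (simp add: length_\<alpha>)

lemma vee_right:
  "j < l \<Longrightarrow> vee \<alpha> \<beta> ! (k - 1 + j) = (if \<beta> ! j < hd \<beta> then \<beta> ! j else \<beta> ! j + last \<alpha> - 1)"
  using nth_vee_right[of \<alpha> j \<beta>] by (simp only: length_\<alpha> length_\<beta> nonempty simp_thms)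

lemma wedge_right:
  "j < l \<Longrightarrow> wedge \<alpha> \<beta> ! (k - 1 + j) =
    (if \<beta> ! j \<le> hd \<beta> then \<beta> ! j + last \<alpha> - 1 else \<beta> ! j + k - 1)"
  using nth_wedge_right[of \<alpha> j \<beta>] by (simp only: length_\<alpha> length_\<beta> Max_\<alpha> nonempty simp_thms)

text \<open>Entries above the pivot \<open>last \<alpha>\<close> are shifted at least as far as the
  others, because \<open>hd \<beta> \<le> l\<close>, so the order is preserved. The next three
  lemmas rest on the same kind of monotone shift.\<close>

lemma vee_left_less_iff:
  assumes "i < k" "j < k"
  shows "vee \<alpha> \<beta> ! j < vee \<alpha> \<beta> ! i \<longleftrightarrow> \<alpha> ! j < \<alpha> ! i"
  unfolding vee_left[OF assms(1)] vee_left[OF assms(2)]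
  using \<alpha>_bounds[OF assms(1)] \<alpha>_bounds[OF assms(2)] last_\<alpha>_bounds hd_\<beta>_bounds by auto

lemma vee_right_less_iff:
  assumes "i < l" "j < l"
  shows "vee \<alpha> \<beta> ! (k - 1 + j) < vee \<alpha> \<beta> ! (k - 1 + i) \<longleftrightarrow> \<beta> ! j < \<beta> ! i"
  unfolding vee_right[OF assms(1)] vee_right[OF assms(2)]
  using \<beta>_bounds[OF assms(1)] \<beta>_bounds[OF assms(2)] last_\<alpha>_bounds hd_\<beta>_bounds by auto

lemma wedge_left_less_iff:
  assumes "i < k" "j < k"
  shows "wedge \<alpha> \<beta> ! j < wedge \<alpha> \<beta> ! i \<longleftrightarrow> \<alpha> ! j < \<alpha> ! i"
  unfolding wedge_left[OF assms(1)] wedge_left[OF assms(2)]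
  using \<alpha>_bounds[OF assms(1)] \<alpha>_bounds[OF assms(2)] last_\<alpha>_bounds hd_\<beta>_bounds by auto

lemma wedge_right_less_iff:
  assumes "i < l" "j < l"
  shows "wedge \<alpha> \<beta> ! (k - 1 + j) < wedge \<alpha> \<beta> ! (k - 1 + i) \<longleftrightarrow> \<beta> ! j < \<beta> ! i"
  unfolding wedge_right[OF assms(1)] wedge_right[OF assms(2)]
  using \<beta>_bounds[OF assms(1)] \<beta>_bounds[OF assms(2)] last_\<alpha>_bounds hd_\<beta>_bounds by auto

text \<open>Left values from \<open>\<alpha> ! i > last \<alpha>\<close> are at least
  \<open>last \<alpha> + l\<close>, above all right values; right values from
  \<open>\<beta> ! j < hd \<beta>\<close> stay below \<open>hd \<beta>\<close>, hence below all left
  values. Otherwise the overlap value \<open>last \<alpha> + hd \<beta> - 1\<close> lies strictly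
  between, left below right.\<close>

lemma vee_cross_less_iff:
  assumes "i < k - 1" "0 < j" "j < l"
  shows "vee \<alpha> \<beta> ! (k - 1 + j) < vee \<alpha> \<beta> ! i \<longleftrightarrow> \<not> (\<alpha> ! i < last \<alpha> \<and> hd \<beta> < \<beta> ! j)"
proof -
  have i: "i < k" using assms(1) by simp
  show ?thesis
    unfolding vee_left[OF i] vee_right[OF assms(3)]
    using \<alpha>_bounds[OF i] \<beta>_bounds[OF assms(3)] last_\<alpha>_bounds hd_\<beta>_bounds
      \<alpha>_ne_last[OF assms(1)] \<beta>_ne_hd[OF assms(2,3)]
    by auto
qed

text \<open>Dually, left values from \<open>\<alpha> ! i < last \<alpha>\<close> lie below all right
  values, and right values from \<open>\<beta> ! j > hd \<beta>\<close> are at least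
  \<open>hd \<beta> + k\<close>, above all left values. Otherwise the overlap value separates the
  two, left above right.\<close>

lemma wedge_cross_less_iff:
  assumes "i < k - 1" "0 < j" "j < l"
  shows "wedge \<alpha> \<beta> ! (k - 1 + j) < wedge \<alpha> \<beta> ! i \<longleftrightarrow> last \<alpha> < \<alpha> ! i \<and> \<beta> ! j < hd \<beta>"
proof -
  have i: "i < k" using assms(1) by simp
  show ?thesis
    unfolding wedge_left[OF i] wedge_right[OF assms(3)]
    using \<alpha>_bounds[OF i] \<beta>_bounds[OF assms(3)] last_\<alpha>_bounds hd_\<beta>_bounds
      \<alpha>_ne_last[OF assms(1)] \<beta>_ne_hd[OF assms(2,3)]
    by auto
qed

text \<open>The overlap position \<open>k - 1\<close> belongs to both blocks: a pair ending there is
  \<open>left\<close>, a pair starting there is \<open>right\<close> with \<open>i' = 0\<close>.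
  Thus \<open>cross\<close> pairs lie strictly on either side of it.\<close>

lemma pair_cases:
  assumes "i < j" "j < k + l - 1"
  obtains (left) "j < k"
  | (right) i' j' where "i = k - 1 + i'" "j = k - 1 + j'" "i' < j'" "j' < l"
  | (cross) j' where "i < k - 1" "j = k - 1 + j'" "0 < j'" "j' < l"
proof -
  consider "j < k" | "k - 1 \<le> i" "k \<le> j" | "i < k - 1" "k \<le> j" by linarith
  then show ?thesis
  proof cases
    case 2
    then show ?thesis
      using assms k by (intro right[of "i - (k - 1)" "j - (k - 1)"]) auto
  next
    case 3
    then show ?thesis
      using assms k by (intro cross[of "j - (k - 1)"]) auto
  qed (rule left)
qed

lemma interval_iff:
  assumes \<gamma>: "length \<gamma> = k + l - 1"
  shows "left_weak_le (wedge \<alpha> \<beta>) \<gamma> \<and> left_weak_le \<gamma> (vee \<alpha> \<beta>) \<longleftrightarrow>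
    same_inversions (take k \<gamma>) \<alpha> \<and> same_inversions (drop (k - 1) \<gamma>) \<beta>"
    (is "?W \<and> ?V \<longleftrightarrow> ?A \<and> ?B")
proof -
  have len: "length (wedge \<alpha> \<beta>) = k + l - 1" "length (vee \<alpha> \<beta>) = k + l - 1"
    using l by (simp_all add: length_wedge length_vee length_\<alpha> length_\<beta>)
  have W: "?W \<longleftrightarrow> (\<forall>j<k + l - 1. \<forall>i<j. wedge \<alpha> \<beta> ! j < wedge \<alpha> \<beta> ! i \<longrightarrow> \<gamma> ! j < \<gamma> ! i)"
    by (rule left_weak_le_iff[OF len(1) \<gamma>])
  have V: "?V \<longleftrightarrow> (\<forall>j<k + l - 1. \<forall>i<j. \<gamma> ! j < \<gamma> ! i \<longrightarrow> vee \<alpha> \<beta> ! j < vee \<alpha> \<beta> ! i)"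
    by (rule left_weak_le_iff[OF \<gamma> len(2)])
  have A: "?A \<longleftrightarrow> (\<forall>j<k. \<forall>i<j. \<gamma> ! j < \<gamma> ! i \<longleftrightarrow> \<alpha> ! j < \<alpha> ! i)"
    using \<gamma> l by (auto simp: same_inversions_def length_\<alpha>)
  have B: "?B \<longleftrightarrow> (\<forall>j<l. \<forall>i<j. \<gamma> ! (k - 1 + j) < \<gamma> ! (k - 1 + i) \<longleftrightarrow> \<beta> ! j < \<beta> ! i)"
    using \<gamma> k by (auto simp: same_inversions_def length_\<beta>)
  show ?thesis
  proof
    assume "?W \<and> ?V"
    then have ?W ?V by auto
    have W': "\<gamma> ! j < \<gamma> ! i" if "wedge \<alpha> \<beta> ! j < wedge \<alpha> \<beta> ! i" "i < j" "j < k + l - 1" for i j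
      using \<open>?W\<close> W that by blast
    have V': "vee \<alpha> \<beta> ! j < vee \<alpha> \<beta> ! i" if "\<gamma> ! j < \<gamma> ! i" "i < j" "j < k + l - 1" for i j
      using \<open>?V\<close> V that by blast
    \<comment> \<open>Inside a block both bounds have the same inversions, so
      \<open>\<gamma>\<close> is squeezed between them.\<close>
    have ?A
      unfolding A
    proof (intro allI impI)
      fix i j assume "j < k" "i < j"
      then show "\<gamma> ! j < \<gamma> ! i \<longleftrightarrow> \<alpha> ! j < \<alpha> ! i"
        using W'[of j i] V'[of j i] vee_left_less_iff[of i j] wedge_left_less_iff[of i j]
          trans_less_add1[of j k "l - 1"] l by auto
    qed
    moreover have ?B
      unfolding B
    proof (intro allI impI)
      fix i j assume "j < l" "i < j"
      moreover from this have "k - 1 + j < k + l - 1" "k - 1 + i < k - 1 + j"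
        using k by linarith+
      ultimately show "\<gamma> ! (k - 1 + j) < \<gamma> ! (k - 1 + i) \<longleftrightarrow> \<beta> ! j < \<beta> ! i"
        using W'[of "k - 1 + j" "k - 1 + i"] V'[of "k - 1 + j" "k - 1 + i"]
          vee_right_less_iff[of i j] wedge_right_less_iff[of i j]
        by (auto simp only:)
    qed
    ultimately show "?A \<and> ?B" ..
  next
    assume "?A \<and> ?B"
    then have ?A ?B by auto
    have A': "\<gamma> ! j < \<gamma> ! i \<longleftrightarrow> \<alpha> ! j < \<alpha> ! i" if "i < j" "j < k" for i j
      using \<open>?A\<close> A that by blast
    have B': "\<gamma> ! (k - 1 + j) < \<gamma> ! (k - 1 + i) \<longleftrightarrow> \<beta> ! j < \<beta> ! i" if "i < j" "j < l" for i j
      using \<open>?B\<close> B that by blast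
    have "(wedge \<alpha> \<beta> ! j < wedge \<alpha> \<beta> ! i \<longrightarrow> \<gamma> ! j < \<gamma> ! i) \<and>
        (\<gamma> ! j < \<gamma> ! i \<longrightarrow> vee \<alpha> \<beta> ! j < vee \<alpha> \<beta> ! i)" if "i < j" "j < k + l - 1" for i j
      using that
    proof (cases rule: pair_cases)
      case left
      then show ?thesis
        using that A'[of i j] vee_left_less_iff[of i j] wedge_left_less_iff[of i j] by auto
    next
      case (right i' j')
      then show ?thesis
        using B'[of i' j'] vee_right_less_iff[of i' j'] wedge_right_less_iff[of i' j'] by auto
    next
      case (cross j')
      \<comment> \<open>A cross pair is compared through the overlap letter
        \<open>\<gamma> ! (k - 1)\<close>, whose relation to either side is fixed by
        \<open>\<alpha>\<close> and \<open>\<beta>\<close>.\<close>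
      have "\<gamma> ! (k - 1) < \<gamma> ! i \<longleftrightarrow> last \<alpha> < \<alpha> ! i"
        using A'[of i "k - 1"] cross by (simp add: last_\<alpha>)
      moreover have "\<gamma> ! j < \<gamma> ! (k - 1) \<longleftrightarrow> \<beta> ! j' < hd \<beta>"
        using B'[of 0 j'] cross by (simp add: hd_\<beta>)
      ultimately show ?thesis
        using cross vee_cross_less_iff[of i j'] wedge_cross_less_iff[of i j'] by fastforce
    qed
    then show "?W \<and> ?V"
      unfolding W V by blast
  qed
qed

section \<open>Coefficients of the product\<close>

lemma std_mem_interval_iff:
  "std w \<in> left_weak_interval (k + l - 1) (wedge \<alpha> \<beta>) (vee \<alpha> \<beta>) \<longleftrightarrow>
    length w = k + l - 1 \<and> std (take k w) = \<alpha> \<and> std (drop (k - 1) w) = \<beta>"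
proof (cases "length w = k + l - 1")
  case True
  then have "std w \<in> left_weak_interval (k + l - 1) (wedge \<alpha> \<beta>) (vee \<alpha> \<beta>) \<longleftrightarrow>
    same_inversions (take k (std w)) \<alpha> \<and> same_inversions (drop (k - 1) (std w)) \<beta>"
    using std_permutation[of w] interval_iff[of "std w"] by (simp add: left_weak_interval_def)
  \<comment> \<open>A prefix of \<open>std w\<close> need not be a permutation of an initial
    segment, but it has the same inversions as the corresponding prefix of \<open>w\<close>;
    likewise for suffixes.\<close>
  also have "\<dots> \<longleftrightarrow> same_inversions (take k w) \<alpha> \<and> same_inversions (drop (k - 1) w) \<beta>"
    using same_inversions_std same_inversions_take same_inversions_drop
      same_inversions_sym same_inversions_trans by meson
  finally show ?thesis
    using True by (simp add: std_eq_iff[OF \<alpha>] std_eq_iff[OF \<beta>])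
next
  case False
  then have "std w \<notin> permutations_of_set {1..k + l - 1}"
    using length_finite_permutations_of_set[of "std w" "{1..k + l - 1}"] by auto
  then show ?thesis
    using False by (simp add: left_weak_interval_def)
qed

lemma sharp_G_eq:
  "(sharp (G \<alpha>) (G \<beta>) :: ('a::linorder, 'k::field) series) w =
    (if length w = k + l - 1 \<and> std (take k w) = \<alpha> \<and> std (drop (k - 1) w) = \<beta> then 1 else 0)"
proof -
  let ?S = "{(p, q). p \<noteq> [] \<and> q \<noteq> [] \<and> word_sharp p q = Some w}"
  let ?z = "(take k w, drop (k - 1) w)"
  have len: "length p = k" if "std p = \<alpha>" for p :: "'a list"
    using that length_\<alpha> by auto
  have len': "length p = l" if "std p = \<beta>" for p :: "'a list"
    using that length_\<beta> by auto
  \<comment> \<open>A nonzero term forces \<open>length p = k\<close>, and this length leaves only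
    the pair \<open>?z\<close>.\<close>
  have off: "G \<alpha> p * G \<beta> q = (0 :: 'k)" if "(p, q) \<in> ?S" "(p, q) \<noteq> ?z" for p q
    using that len[of p] unfolding G_def by (auto simp: word_sharp_eq_Some_iff)
  have z: "?z \<in> ?S" if "length w = k + l - 1"
  proof -
    have "k \<le> length w" "k - 1 < length w"
      using that k l by auto
    then have "take k w \<noteq> []" "drop (k - 1) w \<noteq> []" "length (take k w) = k"
      using k by auto
    then show ?thesis
      using \<open>k \<le> length w\<close> by (simp add: word_sharp_eq_Some_iff)
  qed
  \<comment> \<open>Intersecting with \<open>{?z}\<close> also covers words for which
    \<open>?z\<close> is not a factorization; the sum is then empty.\<close>
  have "sharp (G \<alpha>) (G \<beta>) w = (\<Sum>(p, q) \<in> ?S \<inter> {?z}. G \<alpha> p * G \<beta> q :: 'k)"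
    unfolding sharp_def
  proof (rule sum.mono_neutral_right[OF finite_sharp_pairs Int_lower1], rule ballI)
    fix x assume "x \<in> ?S - ?S \<inter> {?z}"
    then show "(case x of (p, q) \<Rightarrow> G \<alpha> p * G \<beta> q) = (0 :: 'k)"
      using off[of "fst x" "snd x"]
      by (cases x) (simp only: Diff_iff Int_iff prod.case fst_conv snd_conv, blast)
  qed
  also have "\<dots> = (if ?z \<in> ?S \<and> std (take k w) = \<alpha> \<and> std (drop (k - 1) w) = \<beta> then 1 else 0)"
    by (cases "?z \<in> ?S") (auto simp: G_def)
  also have "?z \<in> ?S \<and> std (take k w) = \<alpha> \<and> std (drop (k - 1) w) = \<beta> \<longleftrightarrow>
      length w = k + l - 1 \<and> std (take k w) = \<alpha> \<and> std (drop (k - 1) w) = \<beta>"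
  proof -
    \<comment> \<open>The suffix has length \<open>l \<ge> 1\<close>, so nothing is lost to
      truncation and its length fixes that of \<open>w\<close>.\<close>
    have "length w = k + l - 1" if "std (take k w) = \<alpha>" "std (drop (k - 1) w) = \<beta>"
      using len[OF that(1)] len'[OF that(2)] k l by simp
    then show ?thesis
      using z by blast
  qed
  finally show ?thesis .
qed

end

section \<open>Expansions in the series \<open>G\<close>\<close>

text \<open>The series \<open>G \<gamma>\<close> have disjoint supports: at \<open>w\<close> only
  the index \<open>std w\<close> contributes.\<close>

lemma sum_G:
  fixes c :: "nat list \<Rightarrow> 'k::field"
  assumes "finite P"
  shows "(\<Sum>\<gamma>\<in>P. c \<gamma> * G \<gamma> w) = (if std w \<in> P then c (std w) else 0)"
proof -
  have "(\<Sum>\<gamma>\<in>P. c \<gamma> * G \<gamma> w) = (\<Sum>\<gamma>\<in>P. if std w = \<gamma> then c \<gamma> else 0)"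
    by (intro sum.cong) (auto simp: G_def)
  then show ?thesis
    using assms by simp
qed

text \<open>The second conjunct makes "appearing with coefficient 1" precise: it speaks of every
  finite expansion of the product. Its indices are permutations, since \<open>G \<gamma>\<close>
  vanishes for any other list and its coefficient would be arbitrary.\<close>

theorem theorem4p2:
  fixes a :: "nat \<Rightarrow> 'a::linorder" and \<alpha> \<beta> :: "nat list" and k l :: nat
  assumes alphabet: "strict_mono a" "range a = UNIV"
    and "k \<ge> 1" and "l \<ge> 1"
    and "\<alpha> \<in> permutations_of_set {1..k}" and "\<beta> \<in> permutations_of_set {1..l}"
  shows "sharp (G \<alpha>) (G \<beta>) =
      (\<lambda>w :: 'a list. \<Sum>\<gamma> \<in> left_weak_interval (k + l - 1) (wedge \<alpha> \<beta>) (vee \<alpha> \<beta>).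
         (G \<gamma> w :: 'k::field)) \<and>
    (\<forall>P (c :: nat list \<Rightarrow> 'k).
      finite P \<and> P \<subseteq> (\<Union>n\<in>{1..}. permutations_of_set {1..n}) \<and>
      sharp (G \<alpha>) (G \<beta>) = (\<lambda>w :: 'a list. \<Sum>\<gamma> \<in> P. c \<gamma> * G \<gamma> w) \<longrightarrow>
      {\<gamma> \<in> P. c \<gamma> \<noteq> 0} = left_weak_interval (k + l - 1) (wedge \<alpha> \<beta>) (vee \<alpha> \<beta>) \<and>
      (\<forall>\<gamma> \<in> left_weak_interval (k + l - 1) (wedge \<alpha> \<beta>) (vee \<alpha> \<beta>). c \<gamma> = 1))"
proof -
  interpret permutation_pair \<alpha> \<beta> k l
    using assms by unfold_locales
  let ?I = "left_weak_interval (k + l - 1) (wedge \<alpha> \<beta>) (vee \<alpha> \<beta>)"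
  have coeff: "sharp (G \<alpha>) (G \<beta>) w = (if std w \<in> ?I then 1 else 0 :: 'k)" for w :: "'a list"
    by (simp only: sharp_G_eq std_mem_interval_iff)
  have "sharp (G \<alpha>) (G \<beta>) = (\<lambda>w :: 'a list. \<Sum>\<gamma> \<in> ?I. (G \<gamma> w :: 'k))"
  proof
    fix w :: "'a list"
    show "sharp (G \<alpha>) (G \<beta>) w = (\<Sum>\<gamma> \<in> ?I. (G \<gamma> w :: 'k))"
      using sum_G[OF finite_interval, where c = "\<lambda>_. 1 :: 'k" and w = w]
      by (simp only: coeff mult_1)
  qed
  moreover have "{\<gamma> \<in> P. c \<gamma> \<noteq> 0} = ?I \<and> (\<forall>\<gamma> \<in> ?I. c \<gamma> = 1)"
    if "finite P" and P: "P \<subseteq> (\<Union>n\<in>{1..}. permutations_of_set {1..n})"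
      and eq: "sharp (G \<alpha>) (G \<beta>) = (\<lambda>w :: 'a list. \<Sum>\<gamma> \<in> P. c \<gamma> * G \<gamma> w)"
    for P and c :: "nat list \<Rightarrow> 'k"
  proof -
    have "(if \<gamma> \<in> ?I then 1 else 0) = (if \<gamma> \<in> P then c \<gamma> else 0)"
      if "\<gamma> \<in> permutations_of_set {1..n}" for \<gamma> n
    proof -
      \<comment> \<open>Evaluation at the word \<open>map a \<gamma>\<close> reads off the
        coefficient of \<open>\<gamma>\<close> on both sides.\<close>
      have "std (map a \<gamma>) = \<gamma>"
        using std_eq_iff[OF that] same_inversions_map[OF alphabet(1)] by blast
      then show ?thesis
        using fun_cong[OF eq, of "map a \<gamma>"] coeff[of "map a \<gamma>"] sum_G[OF \<open>finite P\<close>, of c "map a \<gamma>"]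
        by simp
    qed
    moreover have "\<exists>n. \<gamma> \<in> permutations_of_set {1..n}" if "\<gamma> \<in> P \<union> ?I" for \<gamma>
      using that P by (auto simp: left_weak_interval_def)
    ultimately have "(if \<gamma> \<in> ?I then 1 else 0) = (if \<gamma> \<in> P then c \<gamma> else 0)" if "\<gamma> \<in> P \<union> ?I" for \<gamma>
      using that by meson
    then have *: "\<gamma> \<in> ?I \<Longrightarrow> \<gamma> \<in> P \<and> c \<gamma> = 1" "\<gamma> \<in> P \<Longrightarrow> \<gamma> \<notin> ?I \<Longrightarrow> c \<gamma> = 0" for \<gamma>
      by (metis UnCI zero_neq_one)+
    then show ?thesis
      by auto
  qed
  ultimately show ?thesis
    by blast
qed

end
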